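(* Let $0<\alpha<1$, let $m\ge 1$ be an integer, let $\mathcal A$ be a finite set of actions with score maps $S_a$ valued in the extended real line, and let $w_a\ge 0$ ($a\in\mathcal A$) satisfy $\sum_{a\in\mathcal A}w_a\le 1$. For calibration documents $H_1,\dots,H_m$ and a test document $X$ put $$p_a(X)=\frac{1+\sum_{i=1}^m\mathbf 1\{S_a(H_i)\ge S_a(X)\}}{m+1},$$ and say that action $a$ rejects if $p_a(X)\le\alpha w_a$. Then $p_a(X)\ge 1/(m+1)$ for every $a\in\mathcal A$. If $w_a>0$, rejection through action $a$ requires $$m\ge\left\lceil\frac{1}{\alpha w_a}\right\rceil-1 .$$ An action with $w_a=0$ cannot reject for any finite $m$.
   Context: Documents are elements of a measurable space, and each action $a$ (a choice of document prefix length and detector) assigns to every document an extended-real score $S_a$. *)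

theory Defs
  imports "HOL-Analysis.Analysis"
begin

definition conformal_pvalue ::
    "('a \<Rightarrow> 'd \<Rightarrow> ereal) \<Rightarrow> nat \<Rightarrow> (nat \<Rightarrow> 'd) \<Rightarrow> 'a \<Rightarrow> 'd \<Rightarrow> real"
  where
  "conformal_pvalue S m H a X =
     (1 + (\<Sum>i = 1..m. of_bool (S a (H i) \<ge> S a X))) / (real m + 1)"

definition rejects ::
    "real \<Rightarrow> ('a \<Rightarrow> real) \<Rightarrow> ('a \<Rightarrow> 'd \<Rightarrow> ereal) \<Rightarrow> nat \<Rightarrow> (nat \<Rightarrow> 'd) \<Rightarrow> 'a \<Rightarrow> 'd \<Rightarrow> bool"
  where
  "rejects \<alpha> w S m H a X \<longleftrightarrow> conformal_pvalue S m H a X \<le> \<alpha> * w a"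

end

theory Submission
  imports Defs
begin

text \<open>The numerator of the p-value is 1 plus a sum of indicators, so it is at least 1 wherever
  the scores fall. A rejection therefore forces 1/(m+1) \<le> \<alpha> * w a
  (\<open>rejects_imp_inverse_le\<close>), and both the bound on m and the case of zero weight are
  read off from this inequality.\<close>

lemma conformal_pvalue_ge: "1 / (real m + 1) \<le> conformal_pvalue S m H a X"
  unfolding conformal_pvalue_def by (intro divide_right_mono) (simp_all add: sum_nonneg)

lemma rejects_imp_inverse_le: "rejects \<alpha> w S m H a X \<Longrightarrow> 1 / (real m + 1) \<le> \<alpha> * w a"
  unfolding rejects_def using conformal_pvalue_ge by (rule order_trans)

lemma rejects_imp_calibration_size:
  assumes "rejects \<alpha> w S m H a X" and "\<alpha> * w a > 0"
  shows "\<lceil>1 / (\<alpha> * w a)\<rceil> - 1 \<le> int m"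
proof -
  have "1 / (\<alpha> * w a) \<le> real m + 1"
    using rejects_imp_inverse_le[OF assms(1)] assms(2) by (simp add: field_simps)
  \<comment> \<open>The right-hand side is an integer, so the bound passes to the ceiling.\<close>
  then show ?thesis by linarith
qed

text \<open>The threshold is then 0, while 1/(m+1) is strictly positive.\<close>

lemma not_rejects_zero_weight: "w a = 0 \<Longrightarrow> \<not> rejects \<alpha> w S m H a X"
  by (auto dest: rejects_imp_inverse_le simp: field_simps)

theorem corollary4p3:
  fixes \<alpha> :: real and m :: nat
    and A :: "'a set" and w :: "'a \<Rightarrow> real"
    and D :: "'d measure"
    and S :: "'a \<Rightarrow> 'd \<Rightarrow> ereal"
    and H :: "nat \<Rightarrow> 'd" and X :: 'd
  assumes "0 < \<alpha>" and "\<alpha> < 1"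
    and "m \<ge> 1"
    and "finite A"
    and "\<And>a. a \<in> A \<Longrightarrow> w a \<ge> 0"
    and "(\<Sum>a\<in>A. w a) \<le> 1"
    and "\<And>i. i \<in> {1..m} \<Longrightarrow> H i \<in> space D"
    and "X \<in> space D"
  shows "(\<forall>a\<in>A. conformal_pvalue S m H a X \<ge> 1 / (real m + 1))
    \<and> (\<forall>a\<in>A. w a > 0 \<longrightarrow> rejects \<alpha> w S m H a X \<longrightarrow> int m \<ge> \<lceil>1 / (\<alpha> * w a)\<rceil> - 1)
    \<and> (\<forall>a\<in>A. w a = 0 \<longrightarrow> \<not> rejects \<alpha> w S m H a X)"
  \<comment> \<open>With \<alpha> positive, \<open>w a > 0\<close> yields the positive threshold
    that \<open>rejects_imp_calibration_size\<close> asks for.\<close>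
  using assms(1)
  by (simp add: conformal_pvalue_ge rejects_imp_calibration_size not_rejects_zero_weight)

end
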